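(* Let $T>0$ and let $H:[0,T]\to(0,1)$ be Hölder continuous with exponent $\gamma>\sup_{t\in[0,T]}H(t)$. For any $u,v\in[0,T]$, the covariance of the time-varying fractional Brownian motion $B^{H(\cdot)}$ with Hurst function $H$ is $$\mathbb{E}\left[B^{H(\cdot)}(u)B^{H(\cdot)}(v)\right]=2\sqrt{H(u)H(v)}\int_0^{\min(u,v)}(u-s)^{H(u)-\frac12}(v-s)^{H(v)-\frac12}\,ds.$$
   Context: A function $H:[0,T]\to(0,1)$ is Hölder continuous with exponent $\gamma>0$ if there is $C>0$ with $|H(t)-H(s)|\le C|t-s|^\gamma$ for all $t,s\in[0,T]$. Time-varying fractional Brownian motion (TV-fBm): for a standard Brownian motion $\{B_s\}_{s\ge0}$, $$B^{H(\cdot)}(t):=\sqrt{2H(t)}\int_0^t(t-s)^{H(t)-1/2}\,dB_s,\qquad t\in[0,T],$$ where the integral is the Itô integral of a deterministic integrand (the same Brownian motion is used for all $t$). *)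

theory Defs
  imports "HOL-Probability.Probability"
begin

definition hoelder_continuous_on :: "real set \<Rightarrow> real \<Rightarrow> (real \<Rightarrow> real) \<Rightarrow> bool" where
  "hoelder_continuous_on S \<gamma> f \<longleftrightarrow>
     \<gamma> > 0 \<and> (\<exists>C>0. \<forall>s\<in>S. \<forall>t\<in>S. \<bar>f t - f s\<bar> \<le> C * \<bar>t - s\<bar> powr \<gamma>)"

text \<open>Processes indexed by $[0,\infty)$ are modelled as functions on all of \<^typ>\<open>real\<close>;
  their values at negative times are never constrained nor used.
  The second argument of \<^const>\<open>normal_density\<close> is the standard deviation.\<close>

definition standard_brownian_motion :: "'a measure \<Rightarrow> (real \<Rightarrow> 'a \<Rightarrow> real) \<Rightarrow> bool" where
  "standard_brownian_motion M B \<longleftrightarrow>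
     prob_space M \<and>
     (\<forall>t\<ge>0. B t \<in> borel_measurable M) \<and>
     (AE \<omega> in M. B 0 \<omega> = 0) \<and>
     (\<forall>n (t :: nat \<Rightarrow> real). 0 \<le> t 0 \<longrightarrow> (\<forall>i<n. t i \<le> t (Suc i)) \<longrightarrow>
        prob_space.indep_vars M (\<lambda>_. borel) (\<lambda>i \<omega>. B (t (Suc i)) \<omega> - B (t i) \<omega>) {..<n}) \<and>
     (\<forall>s t. 0 \<le> s \<longrightarrow> s < t \<longrightarrow>
        distributed M lborel (\<lambda>\<omega>. B t \<omega> - B s \<omega>) (normal_density 0 (sqrt (t - s)))) \<and>
     (AE \<omega> in M. continuous_on {0..} (\<lambda>t. B t \<omega>))"

text \<open>The Ito integral of a deterministic integrand: for a step function with value \<open>c i\<close> on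
  \<open>(p i, p (i + 1)]\<close> it is the corresponding sum of weighted increments, and for a square-integrable
  $f$ on $[0,t]$ it is the $L^2$-limit of the integrals of step functions that converge
  to $f$ in $L^2([0,t])$.\<close>

definition is_partition :: "real \<Rightarrow> nat \<Rightarrow> (nat \<Rightarrow> real) \<Rightarrow> bool" where
  "is_partition t n p \<longleftrightarrow> p 0 = 0 \<and> p n = t \<and> (\<forall>i<n. p i \<le> p (Suc i))"

definition step_function :: "nat \<Rightarrow> (nat \<Rightarrow> real) \<Rightarrow> (nat \<Rightarrow> real) \<Rightarrow> real \<Rightarrow> real" where
  "step_function n p c s = (\<Sum>i<n. c i * indicator {p i<..p (Suc i)} s)"

definition step_integral ::
    "(real \<Rightarrow> 'a \<Rightarrow> real) \<Rightarrow> nat \<Rightarrow> (nat \<Rightarrow> real) \<Rightarrow> (nat \<Rightarrow> real) \<Rightarrow> 'a \<Rightarrow> real" where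
  "step_integral B n p c \<omega> = (\<Sum>i<n. c i * (B (p (Suc i)) \<omega> - B (p i) \<omega>))"

definition has_ito_integral ::
    "'a measure \<Rightarrow> (real \<Rightarrow> 'a \<Rightarrow> real) \<Rightarrow> real \<Rightarrow> (real \<Rightarrow> real) \<Rightarrow> ('a \<Rightarrow> real) \<Rightarrow> bool" where
  "has_ito_integral M B t f I \<longleftrightarrow>
     set_borel_measurable lborel {0..t} f \<and>
     set_integrable lborel {0..t} (\<lambda>s. (f s)\<^sup>2) \<and>
     I \<in> borel_measurable M \<and>
     integrable M (\<lambda>\<omega>. (I \<omega>)\<^sup>2) \<and>
     (\<exists>n p c. (\<forall>k. is_partition t (n k) (p k)) \<and>
        (\<lambda>k. LINT s:{0..t}|lborel. (step_function (n k) (p k) (c k) s - f s)\<^sup>2)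
          \<longlonglongrightarrow> 0 \<and>
        (\<lambda>k. \<integral>\<omega>. (step_integral B (n k) (p k) (c k) \<omega> - I \<omega>)\<^sup>2 \<partial>M)
          \<longlonglongrightarrow> 0)"

text \<open>The integral is only determined up to almost sure equality; one version is chosen.\<close>

definition ito_integral ::
    "'a measure \<Rightarrow> (real \<Rightarrow> 'a \<Rightarrow> real) \<Rightarrow> real \<Rightarrow> (real \<Rightarrow> real) \<Rightarrow> 'a \<Rightarrow> real" where
  "ito_integral M B t f = (SOME I. has_ito_integral M B t f I)"

text \<open>At \<open>s = t\<close> the kernel has the value \<open>0 powr (H t - 1 / 2) = 0\<close>; this is a null set.\<close>

definition tv_fbm ::
    "'a measure \<Rightarrow> (real \<Rightarrow> 'a \<Rightarrow> real) \<Rightarrow> (real \<Rightarrow> real) \<Rightarrow> real \<Rightarrow> 'a \<Rightarrow> real" where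
  "tv_fbm M B H t \<omega> =
     sqrt (2 * H t) * ito_integral M B t (\<lambda>s. (t - s) powr (H t - 1 / 2)) \<omega>"

definition covariance :: "'a measure \<Rightarrow> ('a \<Rightarrow> real) \<Rightarrow> ('a \<Rightarrow> real) \<Rightarrow> real" where
  "covariance M X Y =
     (\<integral>\<omega>. (X \<omega> - (\<integral>x. X x \<partial>M)) * (Y \<omega> - (\<integral>x. Y x \<partial>M)) \<partial>M)"

end

theory Submission
  imports Defs
begin

text \<open>
  The covariance formula is the Ito isometry in polarized form: if $X$ and $Y$ are the Ito integrals of
  $f$ over $[0,u]$ and of $g$ over $[0,v]$, then $E[XY]$ is the inner product in $L^2(\mathbb{R})$ of
  $f$ and $g$, each extended by zero. For the kernels $f(s) = (u-s)^{H(u)-1/2}$ and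
  $g(s) = (v-s)^{H(v)-1/2}$ the extensions overlap on $[0,\min(u,v)]$, which gives the integral in the
  theorem; the factors $\sqrt{2H(u)}$ and $\sqrt{2H(v)}$ multiply to $2\sqrt{H(u)H(v)}$. Ito
  integrals have mean zero, so the covariance is the expectation of the product.

  The isometry starts from $E[(B_s - B_0)(B_t - B_0)] = \min(s,t)$, which is also the inner product of
  the indicators of $(0,s]$ and $(0,t]$. Bilinearity extends this to all increments
  (\<open>standard_brownian_motion_covariance_increments\<close>) and then to step functions on two
  unrelated partitions (\<open>step_integral_isometry\<close>), and joint continuity of the inner product
  extends it to limits (\<open>has_ito_integral_isometry\<close>).

  All this concerns integrals that exist, and \<^const>\<open>ito_integral\<close> is a choice among the versions of
  the integral, so one has to produce an integral of the kernel. The kernel is nonnegative, continuous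
  on $(0,t)$, and square integrable because $2H(t) - 1 > -1$; hence its lower step functions on
  uniform partitions converge to it in $L^2$ by dominated convergence
  (\<open>lower_step_function_L2_tendsto\<close>). Their step integrals form a Cauchy sequence by the
  isometry, and $L^2$ of the probability space is complete (\<open>L2_complete\<close>).
\<close>

section \<open>Square-integrable functions\<close>

text \<open>Square integrability is kept as a predicate on functions, not on classes modulo null sets, so that
  it applies directly to versions of the integral. Measurability is part of it, as the square of a
  non-measurable function may well be integrable.\<close>

definition square_integrable :: "'a measure \<Rightarrow> ('a \<Rightarrow> real) \<Rightarrow> bool" where
  "square_integrable M f \<longleftrightarrow> f \<in> borel_measurable M \<and> integrable M (\<lambda>x. (f x)\<^sup>2)"

lemma square_integrable_integrable_mult:
  assumes "square_integrable M f" "square_integrable M g"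
  shows "integrable M (\<lambda>x. f x * g x)"
proof (rule Bochner_Integration.integrable_bound)
  show "integrable M (\<lambda>x. (f x)\<^sup>2 + (g x)\<^sup>2)" "(\<lambda>x. f x * g x) \<in> borel_measurable M"
    using assms by (auto simp: square_integrable_def)
  have "\<bar>a * b\<bar> \<le> a\<^sup>2 + b\<^sup>2" for a b :: real
    using sum_squares_bound[of a b] sum_squares_bound[of a "- b"] zero_le_power2[of a] zero_le_power2[of b]
    by (simp add: abs_le_iff; linarith)
  then show "AE x in M. norm (f x * g x) \<le> norm ((f x)\<^sup>2 + (g x)\<^sup>2)"
    by (simp add: order_trans[OF _ abs_ge_self])
qed

lemma square_integrable_cmult [intro]:
  "square_integrable M f \<Longrightarrow> square_integrable M (\<lambda>x. c * f x)"
  by (auto simp: square_integrable_def power_mult_distrib)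

lemma square_integrable_add [intro]:
  assumes "square_integrable M f" "square_integrable M g"
  shows "square_integrable M (\<lambda>x. f x + g x)"
  using assms square_integrable_integrable_mult[OF assms]
  by (auto simp: square_integrable_def power2_sum mult.assoc)

lemma square_integrable_diff [intro]:
  assumes "square_integrable M f" "square_integrable M g"
  shows "square_integrable M (\<lambda>x. f x - g x)"
  using square_integrable_add[OF assms(1) square_integrable_cmult[OF assms(2), of "-1"]] by simp

lemma square_integrable_sum [intro]:
  assumes "\<And>i. i \<in> A \<Longrightarrow> square_integrable M (f i)"
  shows "square_integrable M (\<lambda>x. \<Sum>i\<in>A. f i x)"
  using assms
  by (induction A rule: infinite_finite_induct) (auto, auto simp: square_integrable_def)

text \<open>By bilinearity, two pairs of families with the same Gram matrix have linear combinations with the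
  same inner products. Applied once over the probability space and once over Lebesgue measure, this
  carries the isometry from increments and intervals to step integrals and step functions.\<close>

lemma integral_mult_sum_sum:
  assumes "\<And>i. i \<in> I \<Longrightarrow> square_integrable M (f i)" "\<And>j. j \<in> J \<Longrightarrow> square_integrable M (g j)"
  shows "(\<integral>x. (\<Sum>i\<in>I. c i * f i x) * (\<Sum>j\<in>J. d j * g j x) \<partial>M) =
    (\<Sum>i\<in>I. \<Sum>j\<in>J. c i * d j * (\<integral>x. f i x * g j x \<partial>M))"
proof -
  have "(\<integral>x. (\<Sum>i\<in>I. c i * f i x) * (\<Sum>j\<in>J. d j * g j x) \<partial>M) =
      (\<integral>x. (\<Sum>i\<in>I. \<Sum>j\<in>J. c i * d j * (f i x * g j x)) \<partial>M)"
    by (simp add: sum_product mult_ac)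
  also have "\<dots> = (\<Sum>i\<in>I. \<Sum>j\<in>J. (\<integral>x. c i * d j * (f i x * g j x) \<partial>M))"
  proof -
    have "integrable M (\<lambda>x. c i * d j * (f i x * g j x))" if "i \<in> I" "j \<in> J" for i j
      using assms that by (intro integrable_mult_right square_integrable_integrable_mult)
    then show ?thesis
      by (simp only: Bochner_Integration.integral_sum Bochner_Integration.integrable_sum cong: sum.cong)
  qed
  finally show ?thesis by simp
qed

text \<open>The quadratic form $(y, z) \mapsto \int (yf + zg)^2$ is nonnegative, so its discriminant is not
  positive.\<close>

lemma Cauchy_Schwarz_integral:
  assumes f: "square_integrable M f" and g: "square_integrable M g"
  shows "(\<integral>x. f x * g x \<partial>M)\<^sup>2 \<le> (\<integral>x. (f x)\<^sup>2 \<partial>M) * (\<integral>x. (g x)\<^sup>2 \<partial>M)"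
proof -
  define a b c where "a = (\<integral>x. (f x)\<^sup>2 \<partial>M)" and "b = (\<integral>x. f x * g x \<partial>M)"
    and "c = (\<integral>x. (g x)\<^sup>2 \<partial>M)"
  have int: "integrable M (\<lambda>x. (f x)\<^sup>2)" "integrable M (\<lambda>x. (g x)\<^sup>2)" "integrable M (\<lambda>x. f x * g x)"
    using f g square_integrable_integrable_mult[OF f g] by (auto simp: square_integrable_def)
  have quad: "0 \<le> y\<^sup>2 * a + 2 * y * z * b + z\<^sup>2 * c" for y z
  proof -
    have "0 \<le> (\<integral>x. (y * f x + z * g x)\<^sup>2 \<partial>M)" by simp
    also have "\<dots> = (\<integral>x. y\<^sup>2 * (f x)\<^sup>2 + 2 * y * z * (f x * g x) + z\<^sup>2 * (g x)\<^sup>2 \<partial>M)"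
      by (intro Bochner_Integration.integral_cong) (auto simp: power2_sum power_mult_distrib mult_ac)
    also have "\<dots> = y\<^sup>2 * a + 2 * y * z * b + z\<^sup>2 * c"
      using int by (simp add: a_def b_def c_def)
    finally show ?thesis .
  qed
  have "a \<ge> 0" "c \<ge> 0" by (auto simp: a_def c_def)
  have "b\<^sup>2 \<le> a * c"
  proof (cases "c = 0")
    case True
    have "b = 0"
    proof (rule ccontr)
      assume "b \<noteq> 0"
      \<comment> \<open>At this point the affine form \<open>a + 2 * z * b\<close> takes the value \<open>- 1\<close>.\<close>
      with quad[of 1 "- (a + 1) / (2 * b)"] True show False
        by (simp add: field_simps)
    qed
    then show ?thesis using True by simp
  next
    case False
    have "0 \<le> c * (a * c - b\<^sup>2)"
      using quad[of c "- b"] by (simp add: power2_eq_square algebra_simps)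
    then show ?thesis using False \<open>c \<ge> 0\<close> by (simp add: zero_le_mult_iff)
  qed
  then show ?thesis by (simp add: a_def b_def c_def)
qed

text \<open>The inner product of $L^2$ is jointly continuous: expanding around the limits leaves three
  products with a factor tending to $0$, which the Cauchy--Schwarz inequality controls.\<close>

lemma L2_tendsto_integral_mult:
  assumes X: "\<And>k. square_integrable M (X k)" "square_integrable M X'"
    and Y: "\<And>k. square_integrable M (Y k)" "square_integrable M Y'"
    and lX: "(\<lambda>k. \<integral>x. (X k x - X' x)\<^sup>2 \<partial>M) \<longlonglongrightarrow> 0"
    and lY: "(\<lambda>k. \<integral>x. (Y k x - Y' x)\<^sup>2 \<partial>M) \<longlonglongrightarrow> 0"
  shows "(\<lambda>k. \<integral>x. X k x * Y k x \<partial>M) \<longlonglongrightarrow> (\<integral>x. X' x * Y' x \<partial>M)"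
proof -
  define a b where "a k = (\<integral>x. (X k x - X' x)\<^sup>2 \<partial>M)" and "b k = (\<integral>x. (Y k x - Y' x)\<^sup>2 \<partial>M)" for k
  have to0: "(\<lambda>k. \<integral>x. F k x * G k x \<partial>M) \<longlonglongrightarrow> 0"
    if sq: "\<And>k. square_integrable M (F k)" "\<And>k. square_integrable M (G k)"
    and lim: "(\<lambda>k. (\<integral>x. (F k x)\<^sup>2 \<partial>M) * (\<integral>x. (G k x)\<^sup>2 \<partial>M)) \<longlonglongrightarrow> 0"
    for F G :: "nat \<Rightarrow> 'a \<Rightarrow> real"
  proof -
    have "(\<lambda>k. (\<integral>x. F k x * G k x \<partial>M)\<^sup>2) \<longlonglongrightarrow> 0"
      by (rule tendsto_sandwich[OF _ _ tendsto_const lim])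
        (auto intro!: always_eventually Cauchy_Schwarz_integral sq)
    then have "(\<lambda>k. sqrt ((\<integral>x. F k x * G k x \<partial>M)\<^sup>2)) \<longlonglongrightarrow> sqrt 0"
      by (rule tendsto_real_sqrt)
    then show ?thesis by (simp add: tendsto_rabs_zero_iff)
  qed
  have dX: "square_integrable M (\<lambda>x. X k x - X' x)" and dY: "square_integrable M (\<lambda>x. Y k x - Y' x)" for k
    using X Y by auto
  have "(\<lambda>k. (\<integral>x. (X k x - X' x) * (Y k x - Y' x) \<partial>M) + (\<integral>x. (X k x - X' x) * Y' x \<partial>M)
      + (\<integral>x. X' x * (Y k x - Y' x) \<partial>M) + (\<integral>x. X' x * Y' x \<partial>M)) \<longlonglongrightarrow> 0 + 0 + 0 + (\<integral>x. X' x * Y' x \<partial>M)"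
    by (intro tendsto_add to0 tendsto_const dX dY X Y tendsto_mult_zero tendsto_mult_left_zero
       tendsto_mult_right_zero lX lY)
  moreover have "(\<integral>x. X k x * Y k x \<partial>M) =
     (\<integral>x. (X k x - X' x) * (Y k x - Y' x) \<partial>M) + (\<integral>x. (X k x - X' x) * Y' x \<partial>M)
      + (\<integral>x. X' x * (Y k x - Y' x) \<partial>M) + (\<integral>x. X' x * Y' x \<partial>M)" for k
  proof -
    have i: "integrable M (\<lambda>x. (X k x - X' x) * (Y k x - Y' x))" "integrable M (\<lambda>x. (X k x - X' x) * Y' x)"
      "integrable M (\<lambda>x. X' x * (Y k x - Y' x))" "integrable M (\<lambda>x. X' x * Y' x)"
      by (intro square_integrable_integrable_mult dX dY X Y)+
    have "(\<integral>x. X k x * Y k x \<partial>M) =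
       (\<integral>x. (X k x - X' x) * (Y k x - Y' x) + (X k x - X' x) * Y' x + X' x * (Y k x - Y' x) + X' x * Y' x \<partial>M)"
      by (intro Bochner_Integration.integral_cong) (auto simp: algebra_simps)
    also have "\<dots> = (\<integral>x. (X k x - X' x) * (Y k x - Y' x) \<partial>M) + (\<integral>x. (X k x - X' x) * Y' x \<partial>M)
      + (\<integral>x. X' x * (Y k x - Y' x) \<partial>M) + (\<integral>x. X' x * Y' x \<partial>M)"
      using i by (subst Bochner_Integration.integral_add; (intro Bochner_Integration.integrable_add)?; simp?)+
    finally show ?thesis .
  qed
  ultimately show ?thesis by simp
qed

text \<open>The increments $d_k$ satisfy $\int \sum_k 4^k d_k^2 \le \sum_k 2^{-k} < \infty$. Hence at almost every
  point $4^k d_k^2$ tends to $0$, so that eventually $|d_k| \le 2^{-k}$ and the series of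
  increments converges absolutely. The bound is the product of
  $2^{-k}$, which sums the integrals, and $4^{-k}$, which makes the pointwise increments geometric.\<close>

lemma AE_convergent_if_L2_increments_small:
  fixes X :: "nat \<Rightarrow> 'a \<Rightarrow> real"
  assumes X: "\<And>k. square_integrable M (X k)"
    and small: "\<And>k. (\<integral>x. (X (Suc k) x - X k x)\<^sup>2 \<partial>M) \<le> (1 / 8) ^ k"
  shows "AE x in M. convergent (\<lambda>k. X k x)"
proof -
  have [measurable]: "X k \<in> borel_measurable M" for k
    using X by (simp add: square_integrable_def)
  have int: "integrable M (\<lambda>x. (X (Suc k) x - X k x)\<^sup>2)" for k
    using square_integrable_diff[OF X X, of "Suc k" k] by (simp add: square_integrable_def)
  have "(\<integral>\<^sup>+x. (\<Sum>k. ennreal (4 ^ k * (X (Suc k) x - X k x)\<^sup>2)) \<partial>M)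
      = (\<Sum>k. \<integral>\<^sup>+x. ennreal (4 ^ k * (X (Suc k) x - X k x)\<^sup>2) \<partial>M)"
    by (intro nn_integral_suminf) auto
  also have "\<dots> = (\<Sum>k. ennreal (\<integral>x. 4 ^ k * (X (Suc k) x - X k x)\<^sup>2 \<partial>M))"
    using int by (subst nn_integral_eq_integral) auto
  also have "\<dots> \<le> (\<Sum>k. ennreal ((1 / 2) ^ k))"
  proof (intro suminf_le ennreal_leI allI summableI)
    fix k
    have "(\<integral>x. 4 ^ k * (X (Suc k) x - X k x)\<^sup>2 \<partial>M) \<le> 4 ^ k * (1 / 8) ^ k"
      using small[of k] by simp
    also have "\<dots> = (1 / 2 :: real) ^ k" by (simp flip: power_mult_distrib)
    finally show "(\<integral>x. 4 ^ k * (X (Suc k) x - X k x)\<^sup>2 \<partial>M) \<le> (1 / 2) ^ k" .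
  qed
  also have "\<dots> < \<infinity>"
    by (subst suminf_ennreal2) (simp_all add: summable_geometric)
  finally have "AE x in M. (\<Sum>k. ennreal (4 ^ k * (X (Suc k) x - X k x)\<^sup>2)) \<noteq> \<infinity>"
    by (intro nn_integral_PInf_AE) auto
  then show ?thesis
  proof eventually_elim
    case (elim x)
    then have "summable (\<lambda>k. 4 ^ k * (X (Suc k) x - X k x)\<^sup>2)"
      by (intro summable_suminf_not_top) auto
    then have "(\<lambda>k. 4 ^ k * (X (Suc k) x - X k x)\<^sup>2) \<longlonglongrightarrow> 0"
      by (rule summable_LIMSEQ_zero)
    then have "eventually (\<lambda>k. 4 ^ k * (X (Suc k) x - X k x)\<^sup>2 < 1) sequentially"
      by (rule order_tendstoD) simp
    then have "eventually (\<lambda>k. norm (X (Suc k) x - X k x) \<le> (1 / 2) ^ k) sequentially"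
    proof eventually_elim
      case (elim k)
      have "(2 ^ k * (X (Suc k) x - X k x))\<^sup>2 < 1"
        using elim by (simp add: power_mult_distrib power2_eq_square[of "2 ^ k"] flip: power_mult_distrib[of 2 2])
      then have "\<bar>2 ^ k * (X (Suc k) x - X k x)\<bar> < 1"
        by (simp add: abs_square_less_1)
      then have "2 ^ k * \<bar>X (Suc k) x - X k x\<bar> \<le> 1" by (simp add: abs_mult)
      then show ?case by (simp add: power_one_over pos_le_divide_eq mult.commute)
    qed
    then have "summable (\<lambda>k. X (Suc k) x - X k x)"
      by (rule summable_comparison_test_ev) (simp add: summable_geometric)
    then have "convergent (\<lambda>n. \<Sum>k<n. X (Suc k) x - X k x)"
      by (simp add: summable_iff_convergent)
    then have "convergent (\<lambda>n. X n x - X 0 x)"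
      by (simp only: sum_lessThan_telescope[of "\<lambda>k. X k x"])
    from convergent_add[OF this convergent_const[of "X 0 x"]] show ?case by simp
  qed
qed

text \<open>Riesz--Fischer: a rapidly converging subsequence has a pointwise limit almost everywhere, and
  Fatou's lemma along that subsequence bounds the distance of every late member of the sequence to
  that limit.\<close>

proposition L2_complete:
  fixes X :: "nat \<Rightarrow> 'a \<Rightarrow> real"
  assumes X: "\<And>n. square_integrable M (X n)"
    and Cauchy: "\<And>e. e > 0 \<Longrightarrow> \<exists>N. \<forall>m\<ge>N. \<forall>n\<ge>N. (\<integral>x. (X m x - X n x)\<^sup>2 \<partial>M) < e"
  obtains Y where "square_integrable M Y" "(\<lambda>n. \<integral>x. (X n x - Y x)\<^sup>2 \<partial>M) \<longlonglongrightarrow> 0"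
proof -
  have [measurable]: "X k \<in> borel_measurable M" for k
    using X by (simp add: square_integrable_def)
  have int: "integrable M (\<lambda>x. (X m x - X n x)\<^sup>2)" for m n
    using square_integrable_diff[OF X X, of m n] by (simp add: square_integrable_def)
  have "\<forall>k. \<exists>N. \<forall>m\<ge>N. \<forall>n\<ge>N. (\<integral>x. (X m x - X n x)\<^sup>2 \<partial>M) < (1 / 8) ^ k"
    by (intro allI Cauchy) simp
  then obtain N where N: "\<And>k m n. m \<ge> N k \<Longrightarrow> n \<ge> N k \<Longrightarrow> (\<integral>x. (X m x - X n x)\<^sup>2 \<partial>M) < (1 / 8) ^ k"
    by metis
  \<comment> \<open>Summing the \<open>N i\<close> makes consecutive indices both exceed \<open>N k\<close>; the added \<open>k\<close> makes
    them tend to infinity even if \<open>N\<close> vanishes.\<close>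
  define r where "r k = (\<Sum>i\<le>k. N i) + k" for k
  have r: "r k \<ge> N k" "r (Suc k) \<ge> N k" "r k \<ge> k" for k
    using member_le_sum[of k "{..k}" N] by (auto simp: r_def)
  define Y where "Y x = lim (\<lambda>k. X (r k) x)" for x
  have [measurable]: "Y \<in> borel_measurable M"
    unfolding Y_def by measurable
  have "AE x in M. convergent (\<lambda>k. X (r k) x)"
    using N r by (intro AE_convergent_if_L2_increments_small X) (auto intro!: less_imp_le)
  then have lim: "AE x in M. (\<lambda>k. X (r k) x) \<longlonglongrightarrow> Y x"
    by eventually_elim (simp add: Y_def convergent_LIMSEQ_iff)
  have fatou: "(\<integral>\<^sup>+x. ennreal ((X n x - Y x)\<^sup>2) \<partial>M) \<le> ennreal e"
    if "\<And>m. m \<ge> K \<Longrightarrow> (\<integral>x. (X n x - X m x)\<^sup>2 \<partial>M) < e" for n K e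
  proof -
    have "(\<integral>\<^sup>+x. ennreal ((X n x - Y x)\<^sup>2) \<partial>M)
        = (\<integral>\<^sup>+x. liminf (\<lambda>k. ennreal ((X n x - X (r k) x)\<^sup>2)) \<partial>M)"
    proof (rule nn_integral_cong_AE)
      show "AE x in M. ennreal ((X n x - Y x)\<^sup>2) = liminf (\<lambda>k. ennreal ((X n x - X (r k) x)\<^sup>2))"
        using lim
      proof eventually_elim
        case (elim x)
        then have "(\<lambda>k. ennreal ((X n x - X (r k) x)\<^sup>2)) \<longlonglongrightarrow> ennreal ((X n x - Y x)\<^sup>2)"
          by (intro tendsto_intros)
        then show ?case by (rule lim_imp_Liminf[OF sequentially_bot, symmetric])
      qed
    qed
    also have "\<dots> \<le> liminf (\<lambda>k. \<integral>\<^sup>+x. ennreal ((X n x - X (r k) x)\<^sup>2) \<partial>M)"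
      by (rule nn_integral_liminf) simp
    also have "\<dots> \<le> limsup (\<lambda>k. \<integral>\<^sup>+x. ennreal ((X n x - X (r k) x)\<^sup>2) \<partial>M)"
      by (rule Liminf_le_Limsup) simp
    also have "\<dots> \<le> ennreal e"
    proof (rule Limsup_bounded)
      show "eventually (\<lambda>k. (\<integral>\<^sup>+x. ennreal ((X n x - X (r k) x)\<^sup>2) \<partial>M) \<le> ennreal e) sequentially"
        using eventually_ge_at_top[of K]
      proof eventually_elim
        case (elim k)
        then show ?case
          using that[of "r k"] r(3)[of k] int[of n "r k"]
          by (subst nn_integral_eq_integral) (auto intro!: ennreal_leI)
      qed
    qed
    finally show ?thesis .
  qed
  obtain K where K: "\<And>m n. m \<ge> K \<Longrightarrow> n \<ge> K \<Longrightarrow> (\<integral>x. (X m x - X n x)\<^sup>2 \<partial>M) < 1"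
    using Cauchy[of 1] by auto
  have "(\<integral>\<^sup>+x. ennreal ((X K x - Y x)\<^sup>2) \<partial>M) \<le> ennreal 1"
    by (rule fatou[of K]) (auto intro: K)
  then have "(\<integral>\<^sup>+x. ennreal ((X K x - Y x)\<^sup>2) \<partial>M) < \<infinity>"
    by (rule order_le_less_trans) simp
  then have "integrable M (\<lambda>x. (X K x - Y x)\<^sup>2)"
    by (intro integrableI_nonneg) auto
  then have "square_integrable M (\<lambda>x. X K x - Y x)" by (simp add: square_integrable_def)
  from square_integrable_diff[OF X this, of K] have Y: "square_integrable M Y" by simp
  have "(\<lambda>n. \<integral>x. (X n x - Y x)\<^sup>2 \<partial>M) \<longlonglongrightarrow> 0"
  proof (rule LIMSEQ_I)
    fix e :: real assume "e > 0"
    then obtain K where K: "\<And>m n. m \<ge> K \<Longrightarrow> n \<ge> K \<Longrightarrow> (\<integral>x. (X m x - X n x)\<^sup>2 \<partial>M) < e / 2"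
      using Cauchy[of "e / 2"] by auto
    have "(\<integral>x. (X n x - Y x)\<^sup>2 \<partial>M) < e" if "n \<ge> K" for n
    proof -
      have "ennreal (\<integral>x. (X n x - Y x)\<^sup>2 \<partial>M) \<le> ennreal (e / 2)"
        using fatou[of K n "e / 2"] K[OF that] square_integrable_diff[OF X Y, of n]
        by (subst nn_integral_eq_integral[symmetric]) (auto simp: square_integrable_def)
      with \<open>e > 0\<close> show ?thesis by (simp add: ennreal_le_iff)
    qed
    then show "\<exists>K. \<forall>n\<ge>K. norm ((\<integral>x. (X n x - Y x)\<^sup>2 \<partial>M) - 0) < e"
      by auto
  qed
  with Y show ?thesis by (rule that)
qed

section \<open>Covariances of Brownian increments\<close>

lemma standard_brownian_motion_measurable:
  "standard_brownian_motion M B \<Longrightarrow> t \<ge> 0 \<Longrightarrow> B t \<in> borel_measurable M"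
  by (simp add: standard_brownian_motion_def)

text \<open>The degenerate case \<open>s = t\<close> is included, since cells of a partition may be empty.\<close>

lemma standard_brownian_motion_increment:
  assumes B: "standard_brownian_motion M B" and st: "0 \<le> s" "s \<le> t"
  shows "square_integrable M (\<lambda>\<omega>. B t \<omega> - B s \<omega>)"
    and "(\<integral>\<omega>. (B t \<omega> - B s \<omega>)\<^sup>2 \<partial>M) = t - s"
    and "(\<integral>\<omega>. B t \<omega> - B s \<omega> \<partial>M) = 0"
proof -
  interpret prob_space M using B by (simp add: standard_brownian_motion_def)
  have "square_integrable M (\<lambda>\<omega>. B t \<omega> - B s \<omega>) \<and> (\<integral>\<omega>. (B t \<omega> - B s \<omega>)\<^sup>2 \<partial>M) = t - s
    \<and> (\<integral>\<omega>. B t \<omega> - B s \<omega> \<partial>M) = 0"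
  proof (cases "s = t")
    case True
    then show ?thesis by (simp add: square_integrable_def)
  next
    case False
    with st have lt: "s < t" by simp
    then have \<sigma>: "0 < sqrt (t - s)" by simp
    have D: "distributed M lborel (\<lambda>\<omega>. B t \<omega> - B s \<omega>) (normal_density 0 (sqrt (t - s)))"
      using B st lt by (simp add: standard_brownian_motion_def)
    have mean: "(\<integral>\<omega>. B t \<omega> - B s \<omega> \<partial>M) = 0"
      by (rule normal_distributed_expectation[OF \<sigma> D])
    have "integrable M (\<lambda>\<omega>. (B t \<omega> - B s \<omega>)\<^sup>2)"
      using distributed_integrable[OF D, of "\<lambda>x. x\<^sup>2"] integrable_normal_moment[OF \<sigma>, of 0 2]
      by simp
    moreover have "(\<lambda>\<omega>. B t \<omega> - B s \<omega>) \<in> borel_measurable M"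
      using st standard_brownian_motion_measurable[OF B] by (intro borel_measurable_diff) auto
    moreover have "(\<integral>\<omega>. (B t \<omega> - B s \<omega>)\<^sup>2 \<partial>M) = t - s"
      using normal_distributed_variance[OF \<sigma> D] mean lt by simp
    ultimately show ?thesis using mean by (simp add: square_integrable_def)
  qed
  then show "square_integrable M (\<lambda>\<omega>. B t \<omega> - B s \<omega>)"
    and "(\<integral>\<omega>. (B t \<omega> - B s \<omega>)\<^sup>2 \<partial>M) = t - s"
    and "(\<integral>\<omega>. B t \<omega> - B s \<omega> \<partial>M) = 0" by auto
qed

lemma standard_brownian_motion_indep_increments:
  assumes B: "standard_brownian_motion M B" and "0 \<le> r" "r \<le> s" "s \<le> t"
  shows "prob_space.indep_var M borel (\<lambda>\<omega>. B s \<omega> - B r \<omega>) borel (\<lambda>\<omega>. B t \<omega> - B s \<omega>)"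
proof -
  interpret prob_space M using B by (simp add: standard_brownian_motion_def)
  \<comment> \<open>The times \<open>r\<close>, \<open>s\<close>, \<open>t\<close> as a sequence, whose first two increments are the ones wanted.\<close>
  define p :: "nat \<Rightarrow> real" where "p i = (if i = 0 then r else if i = 1 then s else t)" for i
  have "indep_vars (\<lambda>_. borel) (\<lambda>i \<omega>. B (p (Suc i)) \<omega> - B (p i) \<omega>) {..<2}"
  proof -
    have "\<forall>n (t :: nat \<Rightarrow> real). 0 \<le> t 0 \<longrightarrow> (\<forall>i<n. t i \<le> t (Suc i)) \<longrightarrow>
        indep_vars (\<lambda>_. borel) (\<lambda>i \<omega>. B (t (Suc i)) \<omega> - B (t i) \<omega>) {..<n}"
      using B by (simp add: standard_brownian_motion_def)
    moreover have "0 \<le> p 0" "\<forall>i<2. p i \<le> p (Suc i)" using assms by (auto simp: p_def)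
    ultimately show ?thesis by blast
  qed
  moreover have "{..<2} = insert 0 {1::nat}" by auto
  ultimately have "indep_var borel (\<lambda>\<omega>. B (p (Suc 0)) \<omega> - B (p 0) \<omega>)
      borel (\<lambda>\<omega>. \<Sum>i\<in>{1}. B (p (Suc i)) \<omega> - B (p i) \<omega>)"
    by (intro indep_vars_sum) auto
  then show ?thesis by (simp add: p_def)
qed

text \<open>For \<open>s \<le> t\<close> the longer increment is the shorter one plus an increment that is independent of it
  and has mean zero, so only the variance \<open>s\<close> of the shorter one survives. Subtracting \<open>B 0\<close>
  replaces the almost sure equality \<open>B 0 = 0\<close> by an identity that holds everywhere.\<close>

lemma standard_brownian_motion_covariance_0:
  assumes B: "standard_brownian_motion M B" and "0 \<le> s" "0 \<le> t"
  shows "(\<integral>\<omega>. (B s \<omega> - B 0 \<omega>) * (B t \<omega> - B 0 \<omega>) \<partial>M) = min s t"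
proof -
  interpret prob_space M using B by (simp add: standard_brownian_motion_def)
  have le: "(\<integral>\<omega>. (B s \<omega> - B 0 \<omega>) * (B t \<omega> - B 0 \<omega>) \<partial>M) = s" if st: "0 \<le> s" "s \<le> t" for s t
  proof -
    note sq = standard_brownian_motion_increment(1)[OF B]
    have int: "integrable M (\<lambda>\<omega>. B t \<omega> - B s \<omega>)" if "0 \<le> s" "s \<le> t" for s t
      using sq[OF that] by (auto simp: square_integrable_def intro!: square_integrable_imp_integrable)
    have i: "integrable M (\<lambda>\<omega>. (B s \<omega> - B 0 \<omega>) * (B s \<omega> - B 0 \<omega>))"
        "integrable M (\<lambda>\<omega>. (B s \<omega> - B 0 \<omega>) * (B t \<omega> - B s \<omega>))"
      using st by (auto intro!: square_integrable_integrable_mult sq)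
    have "(\<integral>\<omega>. (B s \<omega> - B 0 \<omega>) * (B t \<omega> - B 0 \<omega>) \<partial>M)
        = (\<integral>\<omega>. (B s \<omega> - B 0 \<omega>) * (B s \<omega> - B 0 \<omega>) + (B s \<omega> - B 0 \<omega>) * (B t \<omega> - B s \<omega>) \<partial>M)"
      by (intro Bochner_Integration.integral_cong) (auto simp: algebra_simps)
    also have "\<dots> = (\<integral>\<omega>. (B s \<omega> - B 0 \<omega>)\<^sup>2 \<partial>M) + (\<integral>\<omega>. (B s \<omega> - B 0 \<omega>) * (B t \<omega> - B s \<omega>) \<partial>M)"
      using Bochner_Integration.integral_add[OF i] by (simp add: power2_eq_square)
    also have "(\<integral>\<omega>. (B s \<omega> - B 0 \<omega>) * (B t \<omega> - B s \<omega>) \<partial>M)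
        = (\<integral>\<omega>. B s \<omega> - B 0 \<omega> \<partial>M) * (\<integral>\<omega>. B t \<omega> - B s \<omega> \<partial>M)"
      using st by (intro indep_var_lebesgue_integral standard_brownian_motion_indep_increments[OF B] int) auto
    finally show ?thesis
      using st standard_brownian_motion_increment(2,3)[OF B] by simp
  qed
  show ?thesis
  proof (cases "s \<le> t")
    case True
    with le[of s t] assms show ?thesis by simp
  next
    case False
    have "(\<integral>\<omega>. (B s \<omega> - B 0 \<omega>) * (B t \<omega> - B 0 \<omega>) \<partial>M) = (\<integral>\<omega>. (B t \<omega> - B 0 \<omega>) * (B s \<omega> - B 0 \<omega>) \<partial>M)"
      by (simp add: mult.commute)
    with le[of t s] assms False show ?thesis by simp
  qed
qed

lemma square_integrable_indicator_interval:
  "square_integrable lborel (indicator {a<..b} :: real \<Rightarrow> real)"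
proof -
  have "(indicator {a<..b} x)\<^sup>2 = (indicator {a<..b} x :: real)" for x :: real
    by (simp split: split_indicator)
  then show ?thesis by (cases "a \<le> b") (simp_all add: square_integrable_def)
qed

text \<open>The map from \<open>{0<..t}\<close> to the increment of \<open>B\<close> over it preserves inner products, because the length
  of \<open>{0<..s} \<inter> {0<..t}\<close> is also \<open>min s t\<close>. Both sides here are differences of two such terms in each
  factor, so arbitrary overlaps of the two intervals need no case distinction.\<close>

lemma standard_brownian_motion_covariance_increments:
  assumes B: "standard_brownian_motion M B" and ab: "0 \<le> a" "a \<le> b" and cd: "0 \<le> c" "c \<le> d"
  shows "(\<integral>\<omega>. (B b \<omega> - B a \<omega>) * (B d \<omega> - B c \<omega>) \<partial>M)
    = (\<integral>s. indicator {a<..b} s * indicator {c<..d} s \<partial>lborel)"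
proof -
  have split: "(\<integral>x. (F b x - F a x) * (F d x - F c x) \<partial>N)
      = (\<integral>x. F b x * F d x \<partial>N) - (\<integral>x. F b x * F c x \<partial>N)
        - ((\<integral>x. F a x * F d x \<partial>N) - (\<integral>x. F a x * F c x \<partial>N))"
    if sq: "\<And>t. t \<ge> 0 \<Longrightarrow> square_integrable N (F t)" for F :: "real \<Rightarrow> 'b \<Rightarrow> real" and N
  proof -
    have i: "integrable N (\<lambda>x. F s x * F t x)" if "s \<ge> 0" "t \<ge> 0" for s t
      using that by (intro square_integrable_integrable_mult sq)
    have "(\<integral>x. (F b x - F a x) * (F d x - F c x) \<partial>N)
        = (\<integral>x. (F b x * F d x - F b x * F c x) - (F a x * F d x - F a x * F c x) \<partial>N)"
      by (intro Bochner_Integration.integral_cong) (auto simp: algebra_simps)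
    also have "\<dots> = (\<integral>x. F b x * F d x \<partial>N) - (\<integral>x. F b x * F c x \<partial>N)
        - ((\<integral>x. F a x * F d x \<partial>N) - (\<integral>x. F a x * F c x \<partial>N))"
      using ab cd i by simp
    finally show ?thesis .
  qed
  have "(\<integral>s. indicator {0<..s'} s * indicator {0<..t'} s \<partial>lborel) = min s' t'"
    if "0 \<le> s'" "0 \<le> t'" for s' t' :: real
  proof -
    have "(\<integral>s. indicator {0<..s'} s * indicator {0<..t'} s \<partial>lborel)
        = (\<integral>s. indicator {0<..min s' t'} s \<partial>lborel :: real)"
      by (intro Bochner_Integration.integral_cong) (auto split: split_indicator)
    then show ?thesis using that by simp
  qed
  then have cov: "(\<integral>\<omega>. (B s \<omega> - B 0 \<omega>) * (B t \<omega> - B 0 \<omega>) \<partial>M)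
      = (\<integral>x. indicator {0<..s} x * indicator {0<..t} x \<partial>lborel)" if "0 \<le> s" "0 \<le> t" for s t
    using that standard_brownian_motion_covariance_0[OF B] by simp
  have "(\<integral>\<omega>. (B b \<omega> - B 0 \<omega> - (B a \<omega> - B 0 \<omega>)) * (B d \<omega> - B 0 \<omega> - (B c \<omega> - B 0 \<omega>)) \<partial>M)
    = (\<integral>s. (indicator {0<..b} s - indicator {0<..a} s) * (indicator {0<..d} s - indicator {0<..c} s) \<partial>lborel)"
    (is "?l = ?r")
  proof -
    have "?l = (\<integral>\<omega>. (B b \<omega> - B 0 \<omega>) * (B d \<omega> - B 0 \<omega>) \<partial>M) - (\<integral>\<omega>. (B b \<omega> - B 0 \<omega>) * (B c \<omega> - B 0 \<omega>) \<partial>M)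
        - ((\<integral>\<omega>. (B a \<omega> - B 0 \<omega>) * (B d \<omega> - B 0 \<omega>) \<partial>M) - (\<integral>\<omega>. (B a \<omega> - B 0 \<omega>) * (B c \<omega> - B 0 \<omega>) \<partial>M))"
      by (intro split standard_brownian_motion_increment(1)[OF B] order_refl)
    also have "\<dots> = ?r"
      using ab cd by (subst split) (auto simp: cov square_integrable_indicator_interval)
    finally show ?thesis .
  qed
  also have "\<dots> = (\<integral>s. indicator {a<..b} s * indicator {c<..d} s \<partial>lborel)"
    using ab cd by (intro Bochner_Integration.integral_cong) (auto split: split_indicator)
  finally show ?thesis by simp
qed

section \<open>The isometry for step integrands\<close>

lemma is_partition_mono:
  assumes "is_partition t n p" "i \<le> j" "j \<le> n"
  shows "p i \<le> p j"
  using assms(2,3)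
proof (induction j rule: dec_induct)
  case (step j)
  moreover have "p j \<le> p (Suc j)" using assms(1) step by (simp add: is_partition_def)
  ultimately show ?case by simp
qed simp

lemma is_partition_bounds:
  assumes "is_partition t n p" "i \<le> n"
  shows "0 \<le> p i" "p i \<le> t"
  using is_partition_mono[OF assms(1), of 0 i] is_partition_mono[OF assms(1), of i n] assms
  by (auto simp: is_partition_def)

lemma square_integrable_step_function: "square_integrable lborel (step_function n p c)"
  unfolding step_function_def
  by (intro square_integrable_sum square_integrable_cmult square_integrable_indicator_interval)

lemma square_integrable_step_integral:
  assumes B: "standard_brownian_motion M B" and p: "is_partition t n p"
  shows "square_integrable M (step_integral B n p c)"
  unfolding step_integral_def using p is_partition_bounds[OF p]
  by (intro square_integrable_sum square_integrable_cmult standard_brownian_motion_increment(1)[OF B])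
     (auto simp: is_partition_def)

text \<open>The two integrals may live on different partitions and different intervals. The covariances of
  overlapping increments are already known, so no common refinement is formed.\<close>

lemma step_integral_isometry:
  assumes B: "standard_brownian_motion M B" and p: "is_partition u n p" and q: "is_partition v m q"
  shows "(\<integral>\<omega>. step_integral B n p c \<omega> * step_integral B m q d \<omega> \<partial>M)
    = (\<integral>s. step_function n p c s * step_function m q d s \<partial>lborel)"
proof -
  have le: "0 \<le> p i" "p i \<le> p (Suc i)" if "i < n" for i
    using that p is_partition_bounds(1)[OF p] by (auto simp: is_partition_def)
  have le': "0 \<le> q i" "q i \<le> q (Suc i)" if "i < m" for i
    using that q is_partition_bounds(1)[OF q] by (auto simp: is_partition_def)
  show ?thesis
    unfolding step_integral_def step_function_def
    by (subst (1 2) integral_mult_sum_sum)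
       (auto intro!: standard_brownian_motion_increment(1)[OF B] square_integrable_indicator_interval
         sum.cong standard_brownian_motion_covariance_increments[OF B] le le')
qed

lemma step_integral_mean_zero:
  assumes B: "standard_brownian_motion M B" and p: "is_partition t n p"
  shows "(\<integral>\<omega>. step_integral B n p c \<omega> \<partial>M) = 0"
proof -
  interpret prob_space M using B by (simp add: standard_brownian_motion_def)
  have le: "0 \<le> p i" "p i \<le> p (Suc i)" if "i < n" for i
    using that p is_partition_bounds(1)[OF p] by (auto simp: is_partition_def)
  have "integrable M (\<lambda>\<omega>. B (p (Suc i)) \<omega> - B (p i) \<omega>)" if "i < n" for i
    using standard_brownian_motion_increment(1)[OF B le[OF that]]
    by (auto simp: square_integrable_def intro!: square_integrable_imp_integrable)
  then show ?thesis
    unfolding step_integral_def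
    using standard_brownian_motion_increment(3)[OF B le] by simp
qed

lemma step_function_outside:
  assumes "is_partition t n p" "s \<notin> {0<..t}"
  shows "step_function n p c s = 0"
proof -
  have "s \<notin> {p i<..p (Suc i)}" if "i < n" for i
    using that assms(2) is_partition_bounds[OF assms(1), of i] is_partition_bounds[OF assms(1), of "Suc i"] by auto
  then show ?thesis by (simp add: step_function_def)
qed

text \<open>Step functions vanish outside \<open>{0<..t}\<close>, so integrals over different intervals become distances in
  one space, $L^2$ of the whole line.\<close>

lemma set_integral_step_function_diff:
  assumes "is_partition t n p"
  shows "(LINT s:{0..t}|lborel. (step_function n p c s - f s)\<^sup>2)
    = (\<integral>s. (step_function n p c s - indicator {0..t} s * f s)\<^sup>2 \<partial>lborel)"
  unfolding set_lebesgue_integral_def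
proof (intro Bochner_Integration.integral_cong refl)
  fix s
  show "indicator {0..t} s *\<^sub>R (step_function n p c s - f s)\<^sup>2
      = (step_function n p c s - indicator {0..t} s * f s)\<^sup>2"
    using step_function_outside[OF assms, of s c] by (auto split: split_indicator)
qed

lemma set_square_integrable_iff:
  "set_borel_measurable lborel A f \<and> set_integrable lborel A (\<lambda>s. (f s)\<^sup>2)
    \<longleftrightarrow> square_integrable lborel (\<lambda>s. indicator A s * f s)"
proof -
  have "(indicator A s * f s)\<^sup>2 = indicator A s * (f s)\<^sup>2" for s
    by (simp split: split_indicator)
  then show ?thesis
    by (simp add: square_integrable_def set_borel_measurable_def set_integrable_def)
qed

section \<open>The Ito integral of a deterministic integrand\<close>

text \<open>Both sides are limits of the same sequence: of the inner products of the approximating step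
  integrals, and of those of the step functions, which agree term by term. In particular the value
  depends neither on the approximating sequences nor on the versions of the integrals.\<close>

theorem has_ito_integral_isometry:
  assumes B: "standard_brownian_motion M B"
    and X: "has_ito_integral M B u f X" and Y: "has_ito_integral M B v g Y"
  shows "(\<integral>\<omega>. X \<omega> * Y \<omega> \<partial>M)
    = (\<integral>s. (indicator {0..u} s * f s) * (indicator {0..v} s * g s) \<partial>lborel)"
proof -
  obtain n p c where p: "\<And>k. is_partition u (n k) (p k)"
    and pf: "(\<lambda>k. LINT s:{0..u}|lborel. (step_function (n k) (p k) (c k) s - f s)\<^sup>2) \<longlonglongrightarrow> 0"
    and pX: "(\<lambda>k. \<integral>\<omega>. (step_integral B (n k) (p k) (c k) \<omega> - X \<omega>)\<^sup>2 \<partial>M) \<longlonglongrightarrow> 0"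
    using X unfolding has_ito_integral_def by blast
  obtain m q d where q: "\<And>k. is_partition v (m k) (q k)"
    and qg: "(\<lambda>k. LINT s:{0..v}|lborel. (step_function (m k) (q k) (d k) s - g s)\<^sup>2) \<longlonglongrightarrow> 0"
    and qY: "(\<lambda>k. \<integral>\<omega>. (step_integral B (m k) (q k) (d k) \<omega> - Y \<omega>)\<^sup>2 \<partial>M) \<longlonglongrightarrow> 0"
    using Y unfolding has_ito_integral_def by blast
  have sq: "square_integrable M X" "square_integrable M Y"
    "square_integrable lborel (\<lambda>s. indicator {0..u} s * f s)"
    "square_integrable lborel (\<lambda>s. indicator {0..v} s * g s)"
    using X Y set_square_integrable_iff[of _ f] set_square_integrable_iff[of _ g]
    by (auto simp: has_ito_integral_def square_integrable_def[of M])
  have "(\<lambda>k. \<integral>\<omega>. step_integral B (n k) (p k) (c k) \<omega> * step_integral B (m k) (q k) (d k) \<omega> \<partial>M)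
      \<longlonglongrightarrow> (\<integral>\<omega>. X \<omega> * Y \<omega> \<partial>M)"
    by (intro L2_tendsto_integral_mult square_integrable_step_integral[OF B p] square_integrable_step_integral[OF B q] sq pX qY)
  moreover have "(\<lambda>k. \<integral>s. step_function (n k) (p k) (c k) s * step_function (m k) (q k) (d k) s \<partial>lborel)
      \<longlonglongrightarrow> (\<integral>s. (indicator {0..u} s * f s) * (indicator {0..v} s * g s) \<partial>lborel)"
    using pf qg
    by (intro L2_tendsto_integral_mult square_integrable_step_function sq)
       (simp_all add: set_integral_step_function_diff[OF p] set_integral_step_function_diff[OF q])
  ultimately show ?thesis
    unfolding step_integral_isometry[OF B p q] by (rule LIMSEQ_unique)
qed

lemma has_ito_integral_mean_zero:
  assumes B: "standard_brownian_motion M B" and X: "has_ito_integral M B t f X"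
  shows "(\<integral>\<omega>. X \<omega> \<partial>M) = 0"
proof -
  interpret prob_space M using B by (simp add: standard_brownian_motion_def)
  obtain n p c where p: "\<And>k. is_partition t (n k) (p k)"
    and pX: "(\<lambda>k. \<integral>\<omega>. (step_integral B (n k) (p k) (c k) \<omega> - X \<omega>)\<^sup>2 \<partial>M) \<longlonglongrightarrow> 0"
    using X unfolding has_ito_integral_def by blast
  have "square_integrable M X" "square_integrable M (\<lambda>_. 1)"
    using X by (auto simp: has_ito_integral_def square_integrable_def)
  then have "(\<lambda>k. \<integral>\<omega>. step_integral B (n k) (p k) (c k) \<omega> * 1 \<partial>M) \<longlonglongrightarrow> (\<integral>\<omega>. X \<omega> * 1 \<partial>M)"
    by (intro L2_tendsto_integral_mult square_integrable_step_integral[OF B p] pX) auto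
  then show ?thesis
    by (simp add: step_integral_mean_zero[OF B p] LIMSEQ_const_iff)
qed

text \<open>A sequence of step functions that converges in $L^2$ is Cauchy, and by the isometry so are its step
  integrals; completeness provides a limit. Existence is what gives meaning to the choice of a
  version in \<^const>\<open>ito_integral\<close>.\<close>

theorem ito_integral_exists_if_approximable:
  assumes B: "standard_brownian_motion M B"
    and f: "square_integrable lborel (\<lambda>s. indicator {0..t} s * f s)"
    and p: "\<And>k. is_partition t (n k) (p k)"
    and lim: "(\<lambda>k. LINT s:{0..t}|lborel. (step_function (n k) (p k) (c k) s - f s)\<^sup>2) \<longlonglongrightarrow> 0"
  shows "has_ito_integral M B t f (ito_integral M B t f)"
proof -
  define F where "F s = indicator {0..t} s * f s" for s
  define G where "G k = step_function (n k) (p k) (c k)" for k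
  define X where "X k = step_integral B (n k) (p k) (c k)" for k
  have sqG: "square_integrable lborel (G k)" and sqX: "square_integrable M (X k)" for k
    unfolding G_def X_def
    by (rule square_integrable_step_function square_integrable_step_integral[OF B p])+
  have sqF: "square_integrable lborel F" using f by (simp add: F_def[abs_def])
  define a where "a k = (\<integral>s. (G k s - F s)\<^sup>2 \<partial>lborel)" for k
  have a: "a \<longlonglongrightarrow> 0"
    using lim by (simp add: a_def[abs_def] G_def F_def set_integral_step_function_diff[OF p])
  have isom: "(\<integral>\<omega>. (X j \<omega> - X k \<omega>)\<^sup>2 \<partial>M) = (\<integral>s. (G j s - G k s)\<^sup>2 \<partial>lborel)" for j k
  proof -
    have expand: "(\<integral>x. (h x - h' x)\<^sup>2 \<partial>N)
        = (\<integral>x. h x * h x \<partial>N) - 2 * (\<integral>x. h x * h' x \<partial>N) + (\<integral>x. h' x * h' x \<partial>N)"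
      if "square_integrable N h" "square_integrable N h'" for N :: "'b measure" and h h'
    proof -
      have i: "integrable N (\<lambda>x. h x * h x)" "integrable N (\<lambda>x. h x * h' x)" "integrable N (\<lambda>x. h' x * h' x)"
        using that by (auto intro: square_integrable_integrable_mult)
      have "(\<integral>x. (h x - h' x)\<^sup>2 \<partial>N) = (\<integral>x. h x * h x - 2 * (h x * h' x) + h' x * h' x \<partial>N)"
        by (intro Bochner_Integration.integral_cong) (auto simp: power2_eq_square algebra_simps)
      then show ?thesis using i by simp
    qed
    have "(\<integral>\<omega>. X j \<omega> * X k \<omega> \<partial>M) = (\<integral>s. G j s * G k s \<partial>lborel)" for j k
      unfolding X_def G_def by (rule step_integral_isometry[OF B p p])
    then show ?thesis by (simp only: expand[OF sqX sqX] expand[OF sqG sqG])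
  qed
  have dist: "(\<integral>s. (G j s - G k s)\<^sup>2 \<partial>lborel) \<le> 2 * a j + 2 * a k" for j k
  proof -
    have i: "integrable lborel (\<lambda>s. (G k s - F s)\<^sup>2)" "integrable lborel (\<lambda>s. (G j s - G k s)\<^sup>2)" for j k
      using square_integrable_diff[OF sqG sqF] square_integrable_diff[OF sqG sqG]
      by (auto simp: square_integrable_def)
    have "(x - y)\<^sup>2 \<le> 2 * (x - z)\<^sup>2 + 2 * (y - z)\<^sup>2" for x y z :: real
      using zero_le_power2[of "(x - z) + (y - z)"] by (simp add: power2_eq_square algebra_simps)
    then have "(\<integral>s. (G j s - G k s)\<^sup>2 \<partial>lborel) \<le> (\<integral>s. 2 * (G j s - F s)\<^sup>2 + 2 * (G k s - F s)\<^sup>2 \<partial>lborel)"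
      using i by (intro integral_mono) auto
    then show ?thesis using i by (simp add: a_def)
  qed
  have "\<exists>N. \<forall>j\<ge>N. \<forall>k\<ge>N. (\<integral>\<omega>. (X j \<omega> - X k \<omega>)\<^sup>2 \<partial>M) < e" if "e > 0" for e
  proof -
    have "eventually (\<lambda>k. a k < e / 4) sequentially"
      using a that by (intro order_tendstoD) auto
    then obtain N where N: "\<And>k. k \<ge> N \<Longrightarrow> a k < e / 4" by (auto simp: eventually_sequentially)
    have "(\<integral>\<omega>. (X j \<omega> - X k \<omega>)\<^sup>2 \<partial>M) < e" if "j \<ge> N" "k \<ge> N" for j k
      using N[OF that(1)] N[OF that(2)] dist[of j k] unfolding isom by linarith
    then show ?thesis by blast
  qed
  then obtain I where I: "square_integrable M I" "(\<lambda>k. \<integral>\<omega>. (X k \<omega> - I \<omega>)\<^sup>2 \<partial>M) \<longlonglongrightarrow> 0"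
    using L2_complete[of M X, OF sqX] by blast
  then have "has_ito_integral M B t f I"
    using set_square_integrable_iff[of "{0..t}" f] f p lim
    by (auto simp: has_ito_integral_def square_integrable_def[of M] X_def)
  then show ?thesis unfolding ito_integral_def by (rule someI[of "has_ito_integral M B t f"])
qed

section \<open>Approximation by lower step functions\<close>

lemma is_partition_cell:
  assumes p: "is_partition t n p" and s: "s \<in> {0<..t}"
  obtains i where "i < n" "s \<in> {p i<..p (Suc i)}"
proof -
  define j where "j = (LEAST j. s \<le> p j)"
  have n: "s \<le> p n" using p s by (simp add: is_partition_def)
  have j: "s \<le> p j" "j \<le> n"
    unfolding j_def using n by (auto intro: LeastI Least_le)
  have "j \<noteq> 0"
  proof
    assume "j = 0"
    with j p s show False by (simp add: is_partition_def)
  qed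
  then obtain i where i: "j = Suc i" by (cases j) auto
  then have "\<not> s \<le> p i" unfolding j_def using not_less_Least[of i "\<lambda>j. s \<le> p j"] by simp
  then show ?thesis using that[of i] i j by simp
qed

lemma step_function_on_cell:
  assumes p: "is_partition t n p" and i: "i < n" and s: "s \<in> {p i<..p (Suc i)}"
  shows "step_function n p c s = c i"
proof -
  have "indicator {p j<..p (Suc j)} s = (0 :: real)" if "j < n" "j \<noteq> i" for j
    using is_partition_mono[OF p, of "Suc j" i] is_partition_mono[OF p, of "Suc i" j] that i s
    by (cases "j < i") (auto split: split_indicator)
  then have "step_function n p c s = (\<Sum>j<n. if j = i then c i else 0)"
    unfolding step_function_def using s by (intro sum.cong) auto
  then show ?thesis using i by simp
qed

text \<open>With \<open>k + 1\<close> cells instead of \<open>k\<close>, the index \<open>0\<close> is not exceptional.\<close>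

definition uniform_partition :: "real \<Rightarrow> nat \<Rightarrow> nat \<Rightarrow> real" where
  "uniform_partition t k i = t * real i / real (Suc k)"

lemma is_partition_uniform: "0 \<le> t \<Longrightarrow> is_partition t (Suc k) (uniform_partition t k)"
  by (auto simp: is_partition_def uniform_partition_def intro!: divide_right_mono mult_left_mono)

text \<open>With the infimum of \<open>f\<close> on each cell the step function stays below \<open>f\<close>, so that \<open>f\<close> itself is a
  square-integrable majorant even where it is unbounded near an end of the interval.\<close>

definition lower_step_value :: "(real \<Rightarrow> real) \<Rightarrow> real \<Rightarrow> nat \<Rightarrow> nat \<Rightarrow> real" where
  "lower_step_value f t k i = Inf (f ` {uniform_partition t k i<..uniform_partition t k (Suc i)})"

text \<open>For the last bound: the cell containing \<open>s\<close> has length \<open>t / (k + 1)\<close>, hence a lower bound of \<open>f\<close> on a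
  neighbourhood of that radius also bounds the infimum over the cell.\<close>

lemma lower_step_function_bounds:
  fixes f :: "real \<Rightarrow> real" and s t l :: real and k :: nat
  assumes nonneg: "\<And>x. 0 \<le> f x" and s: "s \<in> {0<..t}"
  defines "g \<equiv> step_function (Suc k) (uniform_partition t k) (lower_step_value f t k)"
  shows "0 \<le> g s" "g s \<le> f s"
    and "(\<And>x. x > 0 \<Longrightarrow> \<bar>x - s\<bar> \<le> t / real (Suc k) \<Longrightarrow> l \<le> f x) \<Longrightarrow> l \<le> g s"
proof -
  have p: "is_partition t (Suc k) (uniform_partition t k)" using s by (simp add: is_partition_uniform)
  from is_partition_cell[OF p s] obtain i
    where i: "i < Suc k" "s \<in> {uniform_partition t k i<..uniform_partition t k (Suc i)}" .
  let ?C = "{uniform_partition t k i<..uniform_partition t k (Suc i)}"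
  have g: "g s = Inf (f ` ?C)"
    unfolding g_def step_function_on_cell[OF p i] by (simp add: lower_step_value_def)
  have ne: "f ` ?C \<noteq> {}" using i by blast
  have bdd: "bdd_below (f ` ?C)" using nonneg by (auto intro!: bdd_belowI[of _ 0])
  show "0 \<le> g s" unfolding g using nonneg by (intro cInf_greatest ne) auto
  show "g s \<le> f s" unfolding g using i bdd by (intro cInf_lower) auto
  show "l \<le> g s" if l: "\<And>x. x > 0 \<Longrightarrow> \<bar>x - s\<bar> \<le> t / real (Suc k) \<Longrightarrow> l \<le> f x"
    unfolding g
  proof (intro cInf_greatest ne)
    fix y assume "y \<in> f ` ?C"
    then obtain x where x: "x \<in> ?C" "y = f x" by blast
    have "uniform_partition t k (Suc i) = uniform_partition t k i + t / real (Suc k)"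
      by (simp add: uniform_partition_def add_divide_distrib ring_distribs)
    moreover have "0 \<le> uniform_partition t k i"
      using s by (simp add: uniform_partition_def)
    ultimately show "l \<le> y" using x i by (auto intro!: l)
  qed
qed

text \<open>At each point of \<open>{0<..<t}\<close> continuity makes the infima over the shrinking cells converge to the value
  of \<open>f\<close>; the two end points form a null set. The square of the error is at most $f^2$, so dominated
  convergence applies.\<close>

proposition lower_step_function_L2_tendsto:
  assumes t: "0 \<le> t" and nonneg: "\<And>x. 0 \<le> f x" and cont: "continuous_on {0<..<t} f"
    and f: "square_integrable lborel (\<lambda>s. indicator {0..t} s * f s)"
  shows "(\<lambda>k. LINT s:{0..t}|lborel.
      (step_function (Suc k) (uniform_partition t k) (lower_step_value f t k) s - f s)\<^sup>2) \<longlonglongrightarrow> 0"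
proof -
  define g where "g k = step_function (Suc k) (uniform_partition t k) (lower_step_value f t k)" for k
  define F where "F s = indicator {0..t} s * f s" for s
  have F: "square_integrable lborel F" using f by (simp add: F_def[abs_def])
  have meas[measurable]: "g k \<in> borel_measurable lborel" "F \<in> borel_measurable lborel" for k
    using square_integrable_step_function F by (auto simp: g_def square_integrable_def)
  have p: "is_partition t (Suc k) (uniform_partition t k)" for k
    using t by (rule is_partition_uniform)
  have bounds: "0 \<le> g k s \<and> g k s \<le> F s" for k s
  proof (cases "s \<in> {0<..t}")
    case True
    then show ?thesis
      using lower_step_function_bounds(1,2)[OF nonneg True, of k] by (simp add: g_def F_def)
  next
    case False
    then show ?thesis
      using nonneg by (simp add: g_def F_def step_function_outside[OF p])
  qed
  have "(\<lambda>k. \<integral>s. (g k s - F s)\<^sup>2 \<partial>lborel) \<longlonglongrightarrow> (\<integral>s. 0 \<partial>(lborel :: real measure))"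
  proof (rule integral_dominated_convergence)
    show "integrable lborel (\<lambda>s. (F s)\<^sup>2)" using F by (simp add: square_integrable_def)
    show "AE s in lborel. norm ((g k s - F s)\<^sup>2) \<le> (F s)\<^sup>2" for k
      using bounds[of k] by (auto intro!: AE_I2 power2_le_iff_abs_le[THEN iffD2] simp: abs_le_iff)
        (smt (verit))+
    have "AE s in lborel. s \<noteq> 0" "AE s in lborel. s \<noteq> t"
      by (rule AE_lborel_singleton)+
    then show "AE s in lborel. (\<lambda>k. (g k s - F s)\<^sup>2) \<longlonglongrightarrow> 0"
    proof eventually_elim
      case (elim s)
      have "(\<lambda>k. g k s) \<longlonglongrightarrow> F s"
      proof (cases "s \<in> {0<..<t}")
        case False
        with elim have "s \<notin> {0..t}" by auto
        then show ?thesis by (simp add: F_def g_def step_function_outside[OF p])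
      next
        case True
        then have s: "s \<in> {0<..t}" by auto
        have Fs: "F s = f s" using True by (simp add: F_def)
        show ?thesis
        proof (rule LIMSEQ_I)
          fix e :: real assume e: "e > 0"
          have "isCont f s" using cont True by (simp add: continuous_on_eq_continuous_at)
          then obtain d where d: "d > 0" "\<And>x. \<bar>x - s\<bar> < d \<Longrightarrow> \<bar>f x - f s\<bar> < e / 2"
            using e unfolding continuous_at_eps_delta dist_real_def by (metis half_gt_zero)
          have "(\<lambda>k. t / real (Suc k)) \<longlonglongrightarrow> 0"
            by (rule LIMSEQ_Suc[OF lim_const_over_n])
          then have "eventually (\<lambda>k. t / real (Suc k) < d) sequentially"
            using d by (intro order_tendstoD) auto
          then obtain K where K: "\<And>k. k \<ge> K \<Longrightarrow> t / real (Suc k) < d"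
            by (auto simp: eventually_sequentially)
          have "norm (g k s - F s) < e" if "k \<ge> K" for k
          proof -
            have "f s - e / 2 \<le> g k s"
              unfolding g_def
            proof (rule lower_step_function_bounds(3)[OF nonneg s])
              fix x assume "\<bar>x - s\<bar> \<le> t / real (Suc k)"
              with K[OF that] have "\<bar>x - s\<bar> < d" by simp
              from d(2)[OF this] show "f s - e / 2 \<le> f x" by linarith
            qed
            with bounds[of k s] e show ?thesis by (simp add: Fs)
          qed
          then show "\<exists>K. \<forall>k\<ge>K. norm (g k s - F s) < e" by blast
        qed
      qed
      then have "(\<lambda>k. (g k s - F s)\<^sup>2) \<longlonglongrightarrow> (F s - F s)\<^sup>2" by (intro tendsto_intros)
      then show ?case by simp
    qed
  qed simp_all
  then show ?thesis
    unfolding set_integral_step_function_diff[OF p] by (simp add: g_def F_def)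
qed

lemma ito_integral_exists_if_continuous:
  assumes B: "standard_brownian_motion M B" and t: "0 \<le> t" and nonneg: "\<And>x. 0 \<le> f x"
    and cont: "continuous_on {0<..<t} f"
    and f: "square_integrable lborel (\<lambda>s. indicator {0..t} s * f s)"
  shows "has_ito_integral M B t f (ito_integral M B t f)"
  by (rule ito_integral_exists_if_approximable[OF B f is_partition_uniform[OF t] lower_step_function_L2_tendsto[OF t nonneg cont f]])

section \<open>The covariance of time-varying fractional Brownian motion\<close>

text \<open>The square of the kernel is $(t-s)^{2h-1}$, with antiderivative $-(t-s)^{2h}/(2h)$. Since $h > 0$
  this is continuous up to \<open>s = t\<close>, also when the kernel is singular there.\<close>

lemma square_integrable_power_kernel:
  fixes h t :: real
  assumes h: "h > 0" and t: "0 \<le> t"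
  shows "square_integrable lborel (\<lambda>s. indicator {0..t} s * (t - s) powr (h - 1 / 2))"
proof -
  have "((\<lambda>s. (t - s) powr (2 * h - 1)) has_integral
      (- ((t - t) powr (2 * h) / (2 * h)) - (- ((t - 0) powr (2 * h) / (2 * h))))) {0..t}"
  proof (rule fundamental_theorem_of_calculus_interior[OF t])
    show "continuous_on {0..t} (\<lambda>s. - ((t - s) powr (2 * h) / (2 * h)))"
      using h by (intro continuous_intros continuous_on_powr') auto
    fix s assume "s \<in> {0<..<t}"
    then show "((\<lambda>s. - ((t - s) powr (2 * h) / (2 * h))) has_vector_derivative (t - s) powr (2 * h - 1)) (at s)"
      using h unfolding has_real_derivative_iff_has_vector_derivative[symmetric]
      by (auto intro!: derivative_eq_intros)
  qed
  then have "(\<lambda>s. (t - s) powr (2 * h - 1)) absolutely_integrable_on {0..t}"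
    by (intro nonnegative_absolutely_integrable_1) (auto simp: integrable_on_def)
  then have "set_integrable lborel {0..t} (\<lambda>s. (t - s) powr (2 * h - 1))"
    unfolding set_integrable_def by (subst (asm) integrable_completion) auto
  moreover have "(indicator {0..t} s * (t - s) powr (h - 1 / 2))\<^sup>2
      = indicator {0..t} s *\<^sub>R (t - s) powr (2 * h - 1)" for s
    by (auto simp: power2_eq_square powr_add[symmetric] split: split_indicator)
  ultimately show ?thesis
    by (simp add: square_integrable_def set_integrable_def)
qed

lemma has_ito_integral_power_kernel:
  assumes B: "standard_brownian_motion M B" and h: "h > 0" and t: "0 \<le> t"
  shows "has_ito_integral M B t (\<lambda>s. (t - s) powr (h - 1 / 2))
    (ito_integral M B t (\<lambda>s. (t - s) powr (h - 1 / 2)))"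
proof (rule ito_integral_exists_if_continuous[OF B t])
  show "continuous_on {0<..<t} (\<lambda>s. (t - s) powr (h - 1 / 2))"
    by (intro continuous_intros) auto
qed (auto intro: square_integrable_power_kernel[OF h t])

theorem theorem4p2:
  fixes M :: "'a measure" and B :: "real \<Rightarrow> 'a \<Rightarrow> real"
    and H :: "real \<Rightarrow> real" and T \<gamma> u v :: real
  assumes "standard_brownian_motion M B"
    and "T > 0"
    and "\<And>t. t \<in> {0..T} \<Longrightarrow> H t \<in> {0<..<1}"
    and "hoelder_continuous_on {0..T} \<gamma> H"
    and "\<gamma> > (SUP t\<in>{0..T}. H t)"
    and "u \<in> {0..T}" and "v \<in> {0..T}"
  shows "integrable M (\<lambda>\<omega>. tv_fbm M B H u \<omega> * tv_fbm M B H v \<omega>) \<and>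
    set_integrable lborel {0..min u v}
      (\<lambda>s. (u - s) powr (H u - 1 / 2) * (v - s) powr (H v - 1 / 2)) \<and>
    covariance M (tv_fbm M B H u) (tv_fbm M B H v) =
      (\<integral>\<omega>. tv_fbm M B H u \<omega> * tv_fbm M B H v \<omega> \<partial>M) \<and>
    (\<integral>\<omega>. tv_fbm M B H u \<omega> * tv_fbm M B H v \<omega> \<partial>M) =
      2 * sqrt (H u * H v) *
        (LINT s:{0..min u v}|lborel. (u - s) powr (H u - 1 / 2) * (v - s) powr (H v - 1 / 2))"
proof -
  note B = assms(1)
  define K where "K t s = (t - s) powr (H t - 1 / 2)" for t s
  define I where "I t = ito_integral M B t (K t)" for t
  have X: "tv_fbm M B H t = (\<lambda>\<omega>. sqrt (2 * H t) * I t \<omega>)" for t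
    by (simp add: fun_eq_iff tv_fbm_def I_def K_def[abs_def])
  have uv: "0 \<le> u" "0 \<le> v" "H u > 0" "H v > 0" using assms(3,6,7) by auto
  have ito: "has_ito_integral M B t (K t) (I t)" if "t \<in> {u, v}" for t
    using that uv unfolding I_def K_def[abs_def] by (auto intro!: has_ito_integral_power_kernel[OF B])
  have sqK: "square_integrable lborel (\<lambda>s. indicator {0..t} s * K t s)" if "t \<in> {u, v}" for t
    using that uv unfolding K_def by (auto intro!: square_integrable_power_kernel)
  have sqX: "square_integrable M (tv_fbm M B H t)" if "t \<in> {u, v}" for t
    unfolding X using ito[OF that]
    by (intro square_integrable_cmult) (simp add: has_ito_integral_def square_integrable_def)
  have mean: "(\<integral>\<omega>. tv_fbm M B H t \<omega> \<partial>M) = 0" if "t \<in> {u, v}" for t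
    unfolding X using has_ito_integral_mean_zero[OF B ito[OF that]] by simp
  \<comment> \<open>The kernels, extended by zero, overlap exactly on \<open>{0..min u v}\<close>.\<close>
  have ind: "(indicator {0..u} s * K u s) * (indicator {0..v} s * K v s)
      = indicator {0..min u v} s *\<^sub>R (K u s * K v s)" for s
    by (auto split: split_indicator)
  have "integrable M (\<lambda>\<omega>. tv_fbm M B H u \<omega> * tv_fbm M B H v \<omega>)"
    by (intro square_integrable_integrable_mult sqX) auto
  moreover have "set_integrable lborel {0..min u v} (\<lambda>s. K u s * K v s)"
    unfolding set_integrable_def ind[symmetric]
    by (intro square_integrable_integrable_mult sqK) auto
  moreover have "covariance M (tv_fbm M B H u) (tv_fbm M B H v) =
      (\<integral>\<omega>. tv_fbm M B H u \<omega> * tv_fbm M B H v \<omega> \<partial>M)"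
    by (simp add: covariance_def mean)
  moreover have "(\<integral>\<omega>. tv_fbm M B H u \<omega> * tv_fbm M B H v \<omega> \<partial>M)
      = 2 * sqrt (H u * H v) * (LINT s:{0..min u v}|lborel. K u s * K v s)"
  proof -
    have "(\<integral>\<omega>. tv_fbm M B H u \<omega> * tv_fbm M B H v \<omega> \<partial>M)
        = (\<integral>\<omega>. (sqrt (2 * H u) * sqrt (2 * H v)) * (I u \<omega> * I v \<omega>) \<partial>M)"
      unfolding X by (simp add: mult_ac)
    also have "\<dots> = (sqrt (2 * H u) * sqrt (2 * H v)) * (\<integral>\<omega>. I u \<omega> * I v \<omega> \<partial>M)"
      by simp
    also have "(\<integral>\<omega>. I u \<omega> * I v \<omega> \<partial>M) = (LINT s:{0..min u v}|lborel. K u s * K v s)"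
      unfolding set_lebesgue_integral_def ind[symmetric]
      by (intro has_ito_integral_isometry[OF B] ito) auto
    also have "sqrt (2 * H u) * sqrt (2 * H v) = 2 * sqrt (H u * H v)"
      by (simp add: real_sqrt_mult)
    finally show ?thesis .
  qed
  ultimately show ?thesis unfolding K_def by blast
qed

end
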